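(* Let $A\in G_n\mathcal{M}_n$. Then the graphs $\mathcal{G}_{-}(A)$ and $\mathcal{G}_{+}(A)$ are both threshold graphs.
   Context: $\mathcal{S}^n$ is the set of real symmetric $n\times n$ matrices. $\mathcal{M}_n=\{A=(a_{i,j})\in\mathcal{S}^n : a_{i,j}\le a_{k,\ell} \text{ whenever } i\le k,\ j\le \ell,\ i\neq j,\ k\neq \ell\}$. $G_n$ is the group of matrices $PD$ with $P$ an $n\times n$ permutation matrix and $D$ an $n\times n$ diagonal matrix with positive diagonal entries; it acts on $\mathcal{S}^n$ by $g\cdot X=g^\top X g$, and $G_n\mathcal{M}_n=\{g^\top X g : g\in G_n,\ X\in\mathcal{M}_n\}$. For $A\in\mathcal{S}^n$, $\mathcal{G}_{-}(A)$ (resp. $\mathcal{G}_{+}(A)$) is the simple graph on vertex set $\{1,\dots,n\}$ in which distinct $i,j$ are adjacent if and only if $a_{i,j}<0$ (resp. $a_{i,j}>0$). A simple graph is a threshold graph if it can be constructed from a single vertex by iteratively adding a new vertex that is either isolated or adjacent to every vertex already present. *)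

theory Defs
  imports
    "Jordan_Normal_Form.Matrix"
    "Graph_Theory.Pair_Digraph"
    "HOL-Combinatorics.Permutations"
begin

text \<open>
  Matrices have dynamic dimension and are indexed from 0, so the index set
  \<open>{1, \<dots>, n}\<close> of the mathematical text is rendered as \<open>{..<n}\<close>
  (the order-preserving shift by one).
\<close>

definition symmetric_mats :: "nat \<Rightarrow> real mat set" where
  "symmetric_mats n = {A \<in> carrier_mat n n. transpose_mat A = A}"

definition monotone_mats :: "nat \<Rightarrow> real mat set" where
  "monotone_mats n = {A \<in> symmetric_mats n.
     \<forall>i<n. \<forall>j<n. \<forall>k<n. \<forall>l<n.
       i \<le> k \<longrightarrow> j \<le> l \<longrightarrow> i \<noteq> j \<longrightarrow> k \<noteq> l \<longrightarrow> A $$ (i, j) \<le> A $$ (k, l)}"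

definition permutation_mats :: "nat \<Rightarrow> real mat set" where
  "permutation_mats n =
     {mat n n (\<lambda>(i, j). if i = p j then 1 else 0) | p. p permutes {..<n}}"

definition pos_diagonal_mats :: "nat \<Rightarrow> real mat set" where
  "pos_diagonal_mats n = {D \<in> carrier_mat n n. diagonal_mat D \<and> (\<forall>i<n. 0 < D $$ (i, i))}"

definition perm_scaling_group :: "nat \<Rightarrow> real mat set" where
  "perm_scaling_group n = {P * D | P D. P \<in> permutation_mats n \<and> D \<in> pos_diagonal_mats n}"

definition mat_action :: "real mat \<Rightarrow> real mat \<Rightarrow> real mat" where
  "mat_action g X = transpose_mat g * X * g"

definition orbit_monotone_mats :: "nat \<Rightarrow> real mat set" where
  "orbit_monotone_mats n =
     {mat_action g X | g X. g \<in> perm_scaling_group n \<and> X \<in> monotone_mats n}"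

text \<open>
  Following \<open>Graph_Theory\<close>, a finite simple graph is a digraph
  satisfying \<^locale>\<open>pair_graph\<close>: finite, loop-free, and with a symmetric set of arcs,
  an edge between \<open>i\<close> and \<open>j\<close> being the two arcs \<open>(i, j)\<close> and \<open>(j, i)\<close>.
\<close>

definition neg_graph :: "real mat \<Rightarrow> nat pair_pre_digraph" where
  "neg_graph A = \<lparr> pverts = {..<dim_row A},
     parcs = {(i, j). i < dim_row A \<and> j < dim_row A \<and> i \<noteq> j \<and> A $$ (i, j) < 0} \<rparr>"

definition pos_graph :: "real mat \<Rightarrow> nat pair_pre_digraph" where
  "pos_graph A = \<lparr> pverts = {..<dim_row A},
     parcs = {(i, j). i < dim_row A \<and> j < dim_row A \<and> i \<noteq> j \<and> A $$ (i, j) > 0} \<rparr>"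

inductive threshold_graph :: "'a pair_pre_digraph \<Rightarrow> bool" where
  single: "threshold_graph \<lparr> pverts = {v}, parcs = {} \<rparr>"
| add_isolated: "threshold_graph G \<Longrightarrow> v \<notin> pverts G \<Longrightarrow>
    threshold_graph \<lparr> pverts = insert v (pverts G), parcs = parcs G \<rparr>"
| add_dominating: "threshold_graph G \<Longrightarrow> v \<notin> pverts G \<Longrightarrow>
    threshold_graph \<lparr> pverts = insert v (pverts G),
      parcs = parcs G \<union> {v} \<times> pverts G \<union> pverts G \<times> {v} \<rparr>"

lemma pair_graph_iff:
  "pair_graph G \<longleftrightarrow> finite (pverts G) \<and> parcs G \<subseteq> pverts G \<times> pverts G \<and>
     (\<forall>(u, v) \<in> parcs G. u \<noteq> v \<and> (v, u) \<in> parcs G)"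
  (is "?L \<longleftrightarrow> ?R")
proof
  assume ?L
  then interpret pair_graph G .
  show ?R
    using pair_finite_verts in_arcsD1 in_arcsD2 pair_no_loops arcs_symmetric
    by fastforce
next
  assume R: ?R
  then have "finite (parcs G)"
    by (meson finite_SigmaI finite_subset)
  with R show ?L
    by unfold_locales (auto simp: symmetric_def arcs_ends_def arc_to_ends_def sym_def)
qed

lemma threshold_graph_imp_pair_graph:
  "threshold_graph G \<Longrightarrow> pair_graph G"
  by (induction rule: threshold_graph.induct) (unfold pair_graph_iff, auto)

lemma symmetric_mats_index:
  assumes "A \<in> symmetric_mats n" "i < n" "j < n"
  shows "A $$ (j, i) = A $$ (i, j)"
  using assms unfolding symmetric_mats_def
  by (metis (mono_tags, lifting) carrier_matD index_transpose_mat(1) mem_Collect_eq)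

lemma pair_graph_sign_graphs:
  assumes "A \<in> symmetric_mats n"
  shows "pair_graph (neg_graph A)" "pair_graph (pos_graph A)"
  using symmetric_mats_index[OF assms] assms
  by (auto simp: pair_graph_iff neg_graph_def pos_graph_def symmetric_mats_def)

end

theory Submission
  imports Defs
begin

text \<open>
  Acting by a permutation matrix followed by a positive diagonal matrix relabels the rows and
  columns of \<open>X\<close> by a permutation \<open>p\<close> and multiplies each entry by a positive number, so
  \<open>A\<close> has at \<open>(i, j)\<close> the sign of \<open>X\<close> at \<open>(p i, p j)\<close>. If \<open>X\<close> is monotone off the diagonal,
  the adjacency relation of the positive sign graph is therefore preserved when the \<open>p\<close>-ranks
  of both endpoints increase, and that of the negative sign graph when both ranks decrease.

  Any finite nonempty graph with such a ranking is a threshold graph: let \<open>m\<close> be a vertex of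
  least rank and \<open>M\<close> a vertex of greatest rank among the others. If \<open>m\<close> and \<open>M\<close> are adjacent,
  monotonicity makes \<open>M\<close> adjacent to everything; if they are not, it makes \<open>m\<close> isolated.
  Either way one vertex can be removed, and induction applies.
\<close>

lemma threshold_graph_monotone_adjacency:
  fixes f :: "'a \<Rightarrow> 'b::linorder" and Q :: "'a \<Rightarrow> 'a \<Rightarrow> bool"
  assumes "finite V" "V \<noteq> {}"
    and "\<And>i j. i \<in> V \<Longrightarrow> j \<in> V \<Longrightarrow> Q i j \<Longrightarrow> Q j i"
    and "\<And>i j k l. \<lbrakk>i \<in> V; j \<in> V; k \<in> V; l \<in> V; i \<noteq> j; k \<noteq> l; f i \<le> f k; f j \<le> f l; Q i j\<rbrakk>
           \<Longrightarrow> Q k l"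
  shows "threshold_graph \<lparr>pverts = V, parcs = {(i, j). i \<in> V \<and> j \<in> V \<and> i \<noteq> j \<and> Q i j}\<rparr>"
  using assms
proof (induction "card V" arbitrary: V)
  case 0
  then show ?case by simp
next
  case (Suc n)
  note sym = Suc.prems(3) and mono = Suc.prems(4)
  define G where "G W = \<lparr>pverts = W, parcs = {(i, j). i \<in> W \<and> j \<in> W \<and> i \<noteq> j \<and> Q i j}\<rparr>" for W
  have sub: "threshold_graph (G (V - {v}))" if "v \<in> V" "V - {v} \<noteq> {}" for v
    unfolding G_def
  proof (rule Suc.hyps(1))
    show "n = card (V - {v})"
      using Suc.hyps(2) Suc.prems(1) that by simp
    show "finite (V - {v})" "V - {v} \<noteq> {}"
      using Suc.prems(1) that by auto
    show "Q j i" if "i \<in> V - {v}" "j \<in> V - {v}" "Q i j" for i j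
      using sym that by blast
    show "Q k l" if "i \<in> V - {v}" "j \<in> V - {v}" "k \<in> V - {v}" "l \<in> V - {v}"
      "i \<noteq> j" "k \<noteq> l" "f i \<le> f k" "f j \<le> f l" "Q i j" for i j k l
      using mono[of i j k l] that by blast
  qed
  obtain m where m: "m \<in> V" "\<And>x. x \<in> V \<Longrightarrow> f m \<le> f x"
    using arg_min_if_finite[OF Suc.prems(1,2), of f] by (meson not_le)
  have "threshold_graph (G V)"
  proof (cases "V - {m} = {}")
    case True
    with m(1) have "V = {m}" by blast
    then have "G V = \<lparr>pverts = {m}, parcs = {}\<rparr>"
      by (auto simp: G_def)
    then show ?thesis by (simp add: threshold_graph.single)
  next
    case False
    have fin: "finite (f ` (V - {m}))" and ne: "f ` (V - {m}) \<noteq> {}"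
      using Suc.prems(1) False by auto
    obtain M where M: "M \<in> V" "M \<noteq> m" "\<And>x. x \<in> V - {m} \<Longrightarrow> f x \<le> f M"
      using Max_in[OF fin ne] Max_ge[OF fin] by fastforce
    show ?thesis
    proof (cases "Q m M")
      case True
      have dom: "Q j M" "Q M j" if "j \<in> V" "j \<noteq> M" for j
        using mono[of m M j M] sym[of j M] m M True that by auto
      have "G V = \<lparr>pverts = insert M (pverts (G (V - {M}))),
          parcs = parcs (G (V - {M})) \<union> {M} \<times> pverts (G (V - {M})) \<union> pverts (G (V - {M})) \<times> {M}\<rparr>"
        using M(1) dom by (auto simp: G_def)
      moreover have "threshold_graph (G (V - {M}))"
        using sub[of M] m(1) M by blast
      ultimately show ?thesis
        using threshold_graph.add_dominating[of "G (V - {M})" M] by (simp add: G_def)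
    next
      case nadj: False
      have iso: "\<not> Q m j" "\<not> Q j m" if "j \<in> V" "j \<noteq> m" for j
        using mono[of m j m M] sym[of j m] m M nadj that by auto
      have "G V = \<lparr>pverts = insert m (pverts (G (V - {m}))), parcs = parcs (G (V - {m}))\<rparr>"
        using m(1) iso by (auto simp: G_def)
      moreover have "threshold_graph (G (V - {m}))"
        using sub[of m] m(1) False by blast
      ultimately show ?thesis
        using threshold_graph.add_isolated[of "G (V - {m})" m] by (simp add: G_def)
    qed
  qed
  then show ?case by (simp add: G_def)
qed

lemma perm_scaling_groupE:
  assumes "g \<in> perm_scaling_group n"
  obtains p d where "p permutes {..<n}" "\<And>j. j < n \<Longrightarrow> (0::real) < d j"
    "g = mat n n (\<lambda>(i, j). if i = p j then d j else 0)"
proof -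
  obtain p D where p: "p permutes {..<n}" and D: "D \<in> pos_diagonal_mats n"
    and g: "g = mat n n (\<lambda>(i, j). if i = p j then 1 else 0) * D"
    using assms by (auto simp: perm_scaling_group_def permutation_mats_def)
  have Dc: "D \<in> carrier_mat n n" and Dd: "diagonal_mat D" and Dp: "\<And>i. i < n \<Longrightarrow> 0 < D $$ (i, i)"
    using D by (auto simp: pos_diagonal_mats_def)
  have off: "D $$ (k, j) = 0" if "k < n" "j < n" "k \<noteq> j" for k j
    using Dd Dc that by (auto simp: diagonal_mat_def)
  have "g = mat n n (\<lambda>(i, j). if i = p j then D $$ (j, j) else 0)"
  proof (rule eq_matI)
    fix i j
    assume "i < dim_row (mat n n (\<lambda>(i, j). if i = p j then D $$ (j, j) else 0))"
      and "j < dim_col (mat n n (\<lambda>(i, j). if i = p j then D $$ (j, j) else 0))"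
    then have ij: "i < n" "j < n" by auto
    have "g $$ (i, j) = (\<Sum>k<n. (if i = p k then 1 else 0) * D $$ (k, j))"
      using ij Dc by (simp add: g scalar_prod_def lessThan_atLeast0)
    also have "\<dots> = (\<Sum>k<n. if k = j then (if i = p j then D $$ (j, j) else 0) else 0)"
      using ij by (intro sum.cong) (auto simp: off)
    also have "\<dots> = (if i = p j then D $$ (j, j) else 0)"
      using ij by simp
    finally show "g $$ (i, j) = mat n n (\<lambda>(i, j). if i = p j then D $$ (j, j) else 0) $$ (i, j)"
      using ij by simp
  qed (use Dc in \<open>auto simp: g\<close>)
  then show thesis
    using that[of p "\<lambda>j. D $$ (j, j)"] p Dp by blast
qed

lemma mat_action_scaled_permutation_index:
  fixes d :: "nat \<Rightarrow> real"
  assumes p: "p permutes {..<n}" and X: "X \<in> carrier_mat n n" and ij: "i < n" "j < n"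
  shows "mat_action (mat n n (\<lambda>(i, j). if i = p j then d j else 0)) X $$ (i, j)
    = d i * d j * X $$ (p i, p j)"
proof -
  let ?g = "mat n n (\<lambda>(i, j). if i = p j then d j else 0)"
  have pl: "p k < n" if "k < n" for k
    using permutes_in_image[OF p] that by simp
  have gX: "(transpose_mat ?g * X) $$ (i, k) = d i * X $$ (p i, k)" if "k < n" for k
  proof -
    have "(transpose_mat ?g * X) $$ (i, k) = (\<Sum>l<n. (if l = p i then d i else 0) * X $$ (l, k))"
      using ij X that by (simp add: scalar_prod_def lessThan_atLeast0)
    also have "\<dots> = (\<Sum>l<n. if l = p i then d i * X $$ (p i, k) else 0)"
      by (intro sum.cong) auto
    finally show ?thesis using pl ij by simp
  qed
  have "mat_action ?g X $$ (i, j)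
    = (\<Sum>k<n. (transpose_mat ?g * X) $$ (i, k) * (if k = p j then d j else 0))"
    unfolding mat_action_def using ij X
    by (subst index_mult_mat) (auto simp: scalar_prod_def lessThan_atLeast0 simp del: index_mult_mat(1))
  also have "\<dots> = (\<Sum>k<n. if k = p j then d i * d j * X $$ (p i, p j) else 0)"
    by (intro sum.cong) (auto simp: gX simp del: index_mult_mat(1))
  finally show ?thesis using pl ij by simp
qed

theorem proposition6p1:
  fixes n :: nat and A :: "real mat"
  assumes "1 \<le> n"
    and "A \<in> orbit_monotone_mats n"
  shows "threshold_graph (neg_graph A) \<and> threshold_graph (pos_graph A)"
proof -
  obtain g X where g: "g \<in> perm_scaling_group n" and X: "X \<in> monotone_mats n"
    and A: "A = mat_action g X"
    using assms(2) by (auto simp: orbit_monotone_mats_def)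
  have Xs: "X \<in> symmetric_mats n" and Xc: "X \<in> carrier_mat n n"
    using X by (auto simp: monotone_mats_def symmetric_mats_def)
  have Xmono: "X $$ (i, j) \<le> X $$ (k, l)"
    if "i < n" "j < n" "k < n" "l < n" "i \<le> k" "j \<le> l" "i \<noteq> j" "k \<noteq> l" for i j k l
    using X that by (auto simp: monotone_mats_def)
  obtain p d where p: "p permutes {..<n}" and d: "\<And>j. j < n \<Longrightarrow> (0::real) < d j"
    and gpd: "g = mat n n (\<lambda>(i, j). if i = p j then d j else 0)"
    using perm_scaling_groupE[OF g] by blast
  have pl: "p k < n" if "k < n" for k
    using permutes_in_image[OF p] that by simp
  have pinj: "p i = p j \<longleftrightarrow> i = j" for i j
    using permutes_inj[OF p] by (simp add: inj_eq)
  have dim: "dim_row A = n"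
    by (simp add: A mat_action_def gpd)
  have entry: "A $$ (i, j) = d i * d j * X $$ (p i, p j)" if "i < n" "j < n" for i j
    unfolding A gpd using mat_action_scaled_permutation_index[OF p Xc that] .
  have sign: "A $$ (i, j) < 0 \<longleftrightarrow> X $$ (p i, p j) < 0" "0 < A $$ (i, j) \<longleftrightarrow> 0 < X $$ (p i, p j)"
    if "i < n" "j < n" for i j
    using d[OF that(1)] d[OF that(2)]
    by (simp_all add: entry[OF that] mult_less_0_iff zero_less_mult_iff)
  have Xsym: "X $$ (p j, p i) = X $$ (p i, p j)" if "i < n" "j < n" for i j
    using symmetric_mats_index[OF Xs] pl that by blast
  have ne: "{..<n} \<noteq> {}"
    using assms(1) by (simp add: lessThan_empty_iff)
  \<comment> \<open>Negativity passes to smaller entries, so here the ranking is \<open>p\<close> with the opposite sign.\<close>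
  have "threshold_graph \<lparr>pverts = {..<n},
      parcs = {(i, j). i \<in> {..<n} \<and> j \<in> {..<n} \<and> i \<noteq> j \<and> X $$ (p i, p j) < 0}\<rparr>"
  proof (rule threshold_graph_monotone_adjacency[where f = "\<lambda>i. - int (p i)"])
    show "X $$ (p k, p l) < 0"
      if "i \<in> {..<n}" "j \<in> {..<n}" "k \<in> {..<n}" "l \<in> {..<n}" "i \<noteq> j" "k \<noteq> l"
        "- int (p i) \<le> - int (p k)" "- int (p j) \<le> - int (p l)" "X $$ (p i, p j) < 0" for i j k l
      using Xmono[of "p k" "p l" "p i" "p j"] that pl pinj by force
  qed (use ne Xsym in auto)
  moreover have "threshold_graph \<lparr>pverts = {..<n},
      parcs = {(i, j). i \<in> {..<n} \<and> j \<in> {..<n} \<and> i \<noteq> j \<and> 0 < X $$ (p i, p j)}\<rparr>"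
  proof (rule threshold_graph_monotone_adjacency[where f = p])
    show "0 < X $$ (p k, p l)"
      if "i \<in> {..<n}" "j \<in> {..<n}" "k \<in> {..<n}" "l \<in> {..<n}" "i \<noteq> j" "k \<noteq> l"
        "p i \<le> p k" "p j \<le> p l" "0 < X $$ (p i, p j)" for i j k l
      using Xmono[of "p i" "p j" "p k" "p l"] that pl pinj by force
  qed (use ne Xsym in auto)
  moreover have "neg_graph A = \<lparr>pverts = {..<n},
      parcs = {(i, j). i \<in> {..<n} \<and> j \<in> {..<n} \<and> i \<noteq> j \<and> X $$ (p i, p j) < 0}\<rparr>"
    by (auto simp: neg_graph_def dim sign)
  moreover have "pos_graph A = \<lparr>pverts = {..<n},
      parcs = {(i, j). i \<in> {..<n} \<and> j \<in> {..<n} \<and> i \<noteq> j \<and> 0 < X $$ (p i, p j)}\<rparr>"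
    by (auto simp: pos_graph_def dim sign)
  ultimately show ?thesis by simp
qed

end
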